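(* Let $f=(f_1,\dots,f_n):\mathbb{R}^n\to\mathbb{R}^n$ be a real polynomial mapping. Then $$\mathrm{Sol}(f)=\pi_n\big(V_{\mathbb{R}}(\mathcal{I}[f,z])\big).$$
   Context: For a real polynomial mapping $f=(f_1,\dots,f_n):\mathbb{R}^n\to\mathbb{R}^n$, the polynomial complementarity problem $\mathrm{CP}(f)$ asks for $x\in\mathbb{R}^n$ with $x\ge 0$, $f(x)\ge 0$ (componentwise) and $\langle x\mid f(x)\rangle=0$, where $\langle\cdot\mid\cdot\rangle$ is the usual scalar product. Its solution set is denoted $\mathrm{Sol}(f)\subseteq\mathbb{R}^n$. With variables $x=(x_1,\dots,x_n)$ and slack variables $z=(z_1,\dots,z_{2n})$, $\mathcal{I}[f,z]$ is the ideal of $\mathbb{R}[x,z]$ generated by the $3n$ polynomials $x_if_i$, $z_i^2-x_i$, $z_{n+i}^2-f_i$, for $i=1,\dots,n$. For an ideal $\mathcal{I}$ of a real polynomial ring in $N$ variables, $V_{\mathbb{R}}(\mathcal{I})$ is the set of points of $\mathbb{R}^N$ at which all elements of $\mathcal{I}$ vanish. The map $\pi_n$ is the projection onto the first $n$ coordinates, i.e. $\pi_n(x,z)=x$. *)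

theory Defs
  imports "HOL-Analysis.Analysis" "HOL-Library.Poly_Mapping"
begin

text \<open>Real polynomials in variables indexed by \<open>'v\<close>: finitely supported maps from monomials
  (exponent vectors) to coefficients, with the convolution product of
  \<^theory>\<open>HOL-Library.Poly_Mapping\<close>.\<close>

type_synonym 'v rpoly = "('v \<Rightarrow>\<^sub>0 nat) \<Rightarrow>\<^sub>0 real"

definition Const :: "real \<Rightarrow> 'v rpoly" where
  "Const c = Poly_Mapping.single 0 c"

definition Var :: "'v \<Rightarrow> 'v rpoly" where
  "Var v = Poly_Mapping.single (Poly_Mapping.single v 1) 1"

definition subst_poly :: "(real \<Rightarrow> 'a) \<Rightarrow> ('v \<Rightarrow> 'a) \<Rightarrow> 'v rpoly \<Rightarrow> 'a::comm_ring_1" where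
  "subst_poly c s p =
     (\<Sum>m\<in>Poly_Mapping.keys p.
        c (Poly_Mapping.lookup p m) *
        (\<Prod>v\<in>Poly_Mapping.keys m. s v ^ Poly_Mapping.lookup m v))"

definition eval_poly :: "real ^ 'v \<Rightarrow> 'v::finite rpoly \<Rightarrow> real" where
  "eval_poly a p = subst_poly (\<lambda>c. c) (\<lambda>v. a $ v) p"

definition poly_map :: "('n \<Rightarrow> 'n rpoly) \<Rightarrow> real ^ 'n \<Rightarrow> real ^ ('n::finite)" where
  "poly_map f x = (\<chi> i. eval_poly x (f i))"

text \<open>Solutions of the complementarity problem; \<open>\<le>\<close> on vectors is componentwise.\<close>

definition Sol :: "(real ^ 'n \<Rightarrow> real ^ 'n) \<Rightarrow> (real ^ ('n::finite)) set" where
  "Sol g = {x. 0 \<le> x \<and> 0 \<le> g x \<and> x \<bullet> g x = 0}"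

definition is_ideal :: "'a::comm_ring_1 set \<Rightarrow> bool" where
  "is_ideal I \<longleftrightarrow>
     0 \<in> I \<and> (\<forall>p\<in>I. \<forall>q\<in>I. p + q \<in> I) \<and> (\<forall>r. \<forall>p\<in>I. r * p \<in> I)"

definition ideal_generated :: "'a::comm_ring_1 set \<Rightarrow> 'a set" where
  "ideal_generated G = \<Inter>{I. is_ideal I \<and> G \<subseteq> I}"

definition real_variety :: "'v::finite rpoly set \<Rightarrow> (real ^ 'v) set" where
  "real_variety I = {a. \<forall>p\<in>I. eval_poly a p = 0}"

text \<open>The \<open>3n\<close> variables of \<open>\<real>[x,z]\<close> are indexed by \<open>'n + ('n + 'n)\<close>:
  \<open>Inl i\<close> stands for \<open>x\<^sub>i\<close>, \<open>Inr (Inl i)\<close> for \<open>z\<^sub>i\<close> and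
  \<open>Inr (Inr i)\<close> for \<open>z\<^bsub>n+i\<^esub>\<close>.\<close>

type_synonym 'n xz = "'n + ('n + 'n)"

abbreviation x_var :: "'n \<Rightarrow> 'n xz rpoly" where
  "x_var i \<equiv> Var (Inl i)"

abbreviation z_var :: "'n \<Rightarrow> 'n xz rpoly" where
  "z_var i \<equiv> Var (Inr (Inl i))"

abbreviation z_var' :: "'n \<Rightarrow> 'n xz rpoly" where
  "z_var' i \<equiv> Var (Inr (Inr i))"

text \<open>The inclusion of \<open>\<real>[x]\<close> in \<open>\<real>[x,z]\<close>.\<close>

definition embed_xz :: "'n rpoly \<Rightarrow> 'n xz rpoly" where
  "embed_xz p = subst_poly Const x_var p"

definition slack_ideal :: "('n \<Rightarrow> 'n rpoly) \<Rightarrow> 'n xz rpoly set" where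
  "slack_ideal f = ideal_generated
     (range (\<lambda>i. x_var i * embed_xz (f i)) \<union>
      range (\<lambda>i. z_var i ^ 2 - x_var i) \<union>
      range (\<lambda>i. z_var' i ^ 2 - embed_xz (f i)))"

definition proj_x :: "real ^ ('n + 'm::finite) \<Rightarrow> real ^ ('n::finite)" where
  "proj_x w = (\<chi> i. w $ Inl i)"

end

theory Submission
  imports Defs
begin

text \<open>
  At a fixed point, evaluation is a ring homomorphism \<open>\<real>[x,z] \<rightarrow> \<real>\<close>, so the polynomials vanishing
  there form an ideal. Hence the variety of a generated ideal is just the set of common zeros of its
  generators (\<open>real_variety_ideal_generated\<close>), and \<open>(x,z)\<close> lies on the slack variety iff
  \<open>x\<^sub>i f\<^sub>i(x) = 0\<close>, \<open>x\<^sub>i = z\<^sub>i\<^sup>2\<close> and \<open>f\<^sub>i(x) = z\<^bsub>n+i\<^esub>\<^sup>2\<close> for all \<open>i\<close>.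

  A real number is nonnegative iff it is a square, so suitable slack values exist iff \<open>x \<ge> 0\<close> and
  \<open>f(x) \<ge> 0\<close>. For such \<open>x\<close> the inner product \<open>\<langle>x | f(x)\<rangle>\<close> is a sum of nonnegative terms and vanishes
  iff every \<open>x\<^sub>i f\<^sub>i(x)\<close> does. These are the conditions defining \<open>Sol\<close>.
\<close>

section \<open>Evaluation as a ring homomorphism\<close>

definition monom_value :: "real ^ 'v \<Rightarrow> ('v::finite \<Rightarrow>\<^sub>0 nat) \<Rightarrow> real" where
  "monom_value a m = (\<Prod>v\<in>UNIV. (a $ v) ^ Poly_Mapping.lookup m v)"

text \<open>Variables outside the support have exponent \<open>0\<close> and contribute a factor \<open>1\<close>; letting the product
  range over all variables removes the dependence of its index set on the monomial.\<close>

lemma eval_poly_monom_value: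
  "eval_poly a p = (\<Sum>m\<in>Poly_Mapping.keys p. Poly_Mapping.lookup p m * monom_value a m)"
proof -
  have "(\<Prod>v\<in>Poly_Mapping.keys m. (a $ v) ^ Poly_Mapping.lookup m v) = monom_value a m" for m
    unfolding monom_value_def
    by (rule prod.mono_neutral_left) (auto simp: in_keys_iff)
  then show ?thesis
    by (simp add: eval_poly_def subst_poly_def)
qed

lemma eval_poly_superset:
  assumes "finite A" "Poly_Mapping.keys p \<subseteq> A"
  shows "eval_poly a p = (\<Sum>m\<in>A. Poly_Mapping.lookup p m * monom_value a m)"
  unfolding eval_poly_monom_value
  by (rule sum.mono_neutral_left) (use assms in \<open>auto simp: in_keys_iff\<close>)

lemma monom_value_add: "monom_value a (m + n) = monom_value a m * monom_value a n"
  by (simp add: monom_value_def lookup_add power_add prod.distrib)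

lemma monom_value_0 [simp]: "monom_value a 0 = 1"
  by (simp add: monom_value_def)

lemma monom_value_single: "monom_value a (Poly_Mapping.single v 1) = a $ v"
proof -
  have "monom_value a (Poly_Mapping.single v 1) = (\<Prod>u\<in>UNIV. if u = v then a $ u else 1)"
    unfolding monom_value_def
    by (rule prod.cong) (auto simp: lookup_single when_def)
  then show ?thesis by simp
qed

lemma eval_poly_0 [simp]: "eval_poly a 0 = 0"
  by (simp add: eval_poly_monom_value)

lemma eval_poly_single: "eval_poly a (Poly_Mapping.single m c) = c * monom_value a m"
  by (simp add: eval_poly_monom_value)

lemma eval_poly_add [simp]: "eval_poly a (p + q) = eval_poly a p + eval_poly a q"
proof -
  let ?A = "Poly_Mapping.keys p \<union> Poly_Mapping.keys q"
  have "Poly_Mapping.keys (p + q) \<subseteq> ?A"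
    by (rule keys_add)
  then show ?thesis
    by (simp add: eval_poly_superset[of ?A] lookup_add distrib_right sum.distrib)
qed

lemma eval_poly_diff [simp]: "eval_poly a (p - q) = eval_poly a p - eval_poly a q"
  using eval_poly_add[of a "p - q" q] by simp

lemma eval_poly_sum [simp]: "eval_poly a (\<Sum>i\<in>A. p i) = (\<Sum>i\<in>A. eval_poly a (p i))"
  by (induction A rule: infinite_finite_induct) auto

lemma poly_mapping_eq_sum_single:
  "p = (\<Sum>m\<in>Poly_Mapping.keys p. Poly_Mapping.single m (Poly_Mapping.lookup p m))"
  by (rule poly_mapping_eqI)
    (auto simp: lookup_sum lookup_single when_def in_keys_iff)

text \<open>By bilinearity it suffices to multiply single terms, where exponents add and values multiply.\<close>

lemma eval_poly_mult [simp]: "eval_poly a (p * q) = eval_poly a p * eval_poly a q"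
proof -
  let ?t = "\<lambda>p m. Poly_Mapping.single m (Poly_Mapping.lookup p m)"
  have "p * q = (\<Sum>m\<in>Poly_Mapping.keys p. ?t p m) * (\<Sum>n\<in>Poly_Mapping.keys q. ?t q n)"
    by (simp flip: poly_mapping_eq_sum_single)
  also have "\<dots> = (\<Sum>m\<in>Poly_Mapping.keys p. \<Sum>n\<in>Poly_Mapping.keys q.
      Poly_Mapping.single (m + n) (Poly_Mapping.lookup p m * Poly_Mapping.lookup q n))"
    by (simp add: sum_product mult_single)
  finally show ?thesis
    by (simp add: eval_poly_single monom_value_add eval_poly_monom_value[of a p]
        eval_poly_monom_value[of a q] sum_product mult_ac)
qed

lemma eval_poly_Const [simp]: "eval_poly a (Const c) = c"
  by (simp add: Const_def eval_poly_single)

lemma eval_poly_Var [simp]: "eval_poly a (Var v) = a $ v"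
  by (simp only: Var_def eval_poly_single monom_value_single mult_1)

lemma eval_poly_1 [simp]: "eval_poly a 1 = 1"
  using eval_poly_Const[of a 1] by (simp add: Const_def)

lemma eval_poly_power [simp]: "eval_poly a (p ^ k) = eval_poly a p ^ k"
  by (induction k) auto

lemma eval_poly_prod [simp]: "eval_poly a (\<Prod>i\<in>A. p i) = (\<Prod>i\<in>A. eval_poly a (p i))"
  by (induction A rule: infinite_finite_induct) auto

lemma eval_poly_embed_xz [simp]: "eval_poly w (embed_xz p) = eval_poly (proj_x w) p"
proof -
  have "w $ Inl i = proj_x w $ i" for i
    by (simp add: proj_x_def)
  then show ?thesis
    by (simp add: embed_xz_def subst_poly_def eval_poly_def[of "proj_x w"])
qed

section \<open>Varieties of generated ideals\<close>

lemma is_ideal_vanishing: "is_ideal {p. eval_poly a p = 0}"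
  by (simp add: is_ideal_def)

text \<open>The polynomials vanishing at a common zero of \<open>G\<close> form an ideal containing \<open>G\<close>, hence containing
  everything that \<open>G\<close> generates.\<close>

lemma real_variety_ideal_generated:
  "real_variety (ideal_generated G) = {a. \<forall>p\<in>G. eval_poly a p = 0}"
proof -
  have "ideal_generated G \<subseteq> {p. eval_poly a p = 0}" if "G \<subseteq> {p. eval_poly a p = 0}" for a
    unfolding ideal_generated_def using is_ideal_vanishing[of a] that by blast
  moreover have "G \<subseteq> ideal_generated G"
    by (auto simp: ideal_generated_def)
  ultimately show ?thesis
    by (auto simp: real_variety_def)
qed

lemma mem_real_variety_slack_ideal_iff:
  "w \<in> real_variety (slack_ideal f) \<longleftrightarrow>
     (\<forall>i. w $ Inl i * eval_poly (proj_x w) (f i) = 0 \<and>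
          w $ Inl i = (w $ Inr (Inl i))\<^sup>2 \<and>
          eval_poly (proj_x w) (f i) = (w $ Inr (Inr i))\<^sup>2)"
  by (auto simp: slack_ideal_def real_variety_ideal_generated ball_Un)

section \<open>Complementarity and squares\<close>

text \<open>Under the sign conditions no cancellation can occur in the inner product.\<close>

lemma mem_Sol_iff:
  "x \<in> Sol g \<longleftrightarrow> (\<forall>i. 0 \<le> x $ i \<and> 0 \<le> g x $ i \<and> x $ i * g x $ i = 0)"
proof -
  have "x \<bullet> g x = 0 \<longleftrightarrow> (\<forall>i. x $ i * g x $ i = 0)"
    if "\<forall>i. 0 \<le> x $ i" "\<forall>i. 0 \<le> g x $ i"
    unfolding inner_vec_def inner_real_def
    using that by (subst sum_nonneg_eq_0_iff) auto
  then show ?thesis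
    by (auto simp: Sol_def less_eq_vec_def)
qed

theorem proposition3p1:
  fixes f :: "'n::finite \<Rightarrow> 'n rpoly"
  shows "Sol (poly_map f) = proj_x ` real_variety (slack_ideal f)"
proof (intro equalityI subsetI)
  fix x assume "x \<in> Sol (poly_map f)"
  then have x: "0 \<le> x $ i" "0 \<le> eval_poly x (f i)" "x $ i * eval_poly x (f i) = 0" for i
    by (simp_all add: mem_Sol_iff poly_map_def)
  define w :: "real ^ 'n xz" where
    "w = (\<chi> v. case v of Inl i \<Rightarrow> x $ i
                 | Inr (Inl i) \<Rightarrow> sqrt (x $ i)
                 | Inr (Inr i) \<Rightarrow> sqrt (eval_poly x (f i)))"
  have proj: "proj_x w = x"
    by (simp add: proj_x_def w_def vec_eq_iff)
  have "w \<in> real_variety (slack_ideal f)"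
    using x by (simp add: mem_real_variety_slack_ideal_iff proj) (simp add: w_def)
  then show "x \<in> proj_x ` real_variety (slack_ideal f)"
    using proj by blast
next
  fix x assume "x \<in> proj_x ` real_variety (slack_ideal f)"
  then obtain w where w: "w \<in> real_variety (slack_ideal f)" and x: "x = proj_x w"
    by blast
  have "w $ Inl i = x $ i" for i
    by (simp add: x proj_x_def)
  with w show "x \<in> Sol (poly_map f)"
    unfolding mem_Sol_iff mem_real_variety_slack_ideal_iff poly_map_def
    by (metis vec_lambda_beta x zero_le_power2)
qed

end
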